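(* Let $v\neq 1$ and $\mu>0$. For the inverse central harmonic oscillator $\mathbf{F}(\mathbf{r})=-m\,\hat{\mathbf{r}}/r$, there are two constant-speed ramps $\alpha_{ls}$ (with velocity $v$ and friction coefficient $\mu$) that are logarithmic spirals, whose TreadmillSled curves $\gamma_{ls}$ are half-lines through the origin $O$.
   Context: A particle of mass $m$ slides along a plane curve (the ramp) with constant speed $v>0$ under a central force $\mathbf{F}(\mathbf{r})=F(r)\hat{\mathbf{r}}$, where $r=|\mathbf{r}|$ and $\hat{\mathbf{r}}=\mathbf{r}/r$, the normal force exerted by the ramp, and a friction force with kinetic friction coefficient $\mu>0$. For the inverse central harmonic oscillator, $F(r)=-m/r$. For a curve $\alpha$ in $\mathbb{R}^2\setminus\{0\}$ parametrized by arc-length $s$, put $\mathbf{n}(s)=J\alpha'(s)$ with $J(x,y)=(-y,x)$, and $\kappa(s)=\langle\alpha''(s),\mathbf{n}(s)\rangle$. The curve $\alpha$ is a constant-speed ramp with velocity $v$ if and only if $\frac{F(r)}{|\alpha(s)|}\langle\alpha(s),\alpha'(s)\rangle\ge 0$ and $$\kappa(s)=\frac{F(r)}{mv^2r}\left(\frac{\langle\alpha(s),\alpha'(s)\rangle}{\mu}+\langle\alpha(s),\mathbf{n}(s)\rangle\right),\qquad r=|\alpha(s)|.$$ If a curve satisfies the curvature equation but not the sign condition, one reverses its orientation; in this sense every curve satisfying the curvature equation defines a ramp once its orientation is properly selected. The TreadmillSled of an arc-length parametrized curve $\alpha$ is the curve $\gamma(s)=-(\langle\alpha(s),\alpha'(s)\rangle,\langle\alpha(s),\mathbf{n}(s)\rangle)$;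 the notion is independent of orientation-preserving reparametrizations. The half-lines here are those starting at the origin. *)

theory Defs
  imports "HOL-Analysis.Analysis"
begin

type_synonym plane = "real \<times> real"

definition J :: "plane \<Rightarrow> plane" where
  "J p = (- snd p, fst p)"

definition rot :: "real \<Rightarrow> plane \<Rightarrow> plane" where
  "rot \<phi> p = (cos \<phi> * fst p - sin \<phi> * snd p, sin \<phi> * fst p + cos \<phi> * snd p)"

definition tangent :: "(real \<Rightarrow> plane) \<Rightarrow> real \<Rightarrow> plane" where
  "tangent \<alpha> s = vector_derivative \<alpha> (at s)"

definition normal :: "(real \<Rightarrow> plane) \<Rightarrow> real \<Rightarrow> plane" where
  "normal \<alpha> s = J (tangent \<alpha> s)"

definition acceleration :: "(real \<Rightarrow> plane) \<Rightarrow> real \<Rightarrow> plane" where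
  "acceleration \<alpha> s = vector_derivative (tangent \<alpha>) (at s)"

definition curvature :: "(real \<Rightarrow> plane) \<Rightarrow> real \<Rightarrow> real" where
  "curvature \<alpha> s = acceleration \<alpha> s \<bullet> normal \<alpha> s"

text \<open>A curve is a pair of an open interval \<open>D\<close> and a function whose values off \<open>D\<close>
  are irrelevant.\<close>

definition arclength_curve :: "real set \<Rightarrow> (real \<Rightarrow> plane) \<Rightarrow> bool" where
  "arclength_curve D \<alpha> \<longleftrightarrow>
     open D \<and> is_interval D \<and> D \<noteq> {} \<and>
     (\<forall>s\<in>D. \<alpha> differentiable (at s) \<and> tangent \<alpha> differentiable (at s)) \<and>
     continuous_on D (acceleration \<alpha>) \<and>
     (\<forall>s\<in>D. norm (tangent \<alpha> s) = 1) \<and>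
     (\<forall>s\<in>D. \<alpha> s \<noteq> 0)"

definition curvature_equation ::
  "real \<Rightarrow> (real \<Rightarrow> real) \<Rightarrow> real \<Rightarrow> real \<Rightarrow> real set \<Rightarrow> (real \<Rightarrow> plane) \<Rightarrow> bool" where
  "curvature_equation m F v \<mu> D \<alpha> \<longleftrightarrow>
     (\<forall>s\<in>D. curvature \<alpha> s =
        F (norm (\<alpha> s)) / (m * v\<^sup>2 * norm (\<alpha> s)) *
        ((\<alpha> s \<bullet> tangent \<alpha> s) / \<mu> + \<alpha> s \<bullet> normal \<alpha> s))"

definition sign_condition :: "(real \<Rightarrow> real) \<Rightarrow> real set \<Rightarrow> (real \<Rightarrow> plane) \<Rightarrow> bool" where
  "sign_condition F D \<alpha> \<longleftrightarrow>
     (\<forall>s\<in>D. F (norm (\<alpha> s)) / norm (\<alpha> s) * (\<alpha> s \<bullet> tangent \<alpha> s) \<ge> 0)"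

definition constant_speed_ramp ::
  "real \<Rightarrow> (real \<Rightarrow> real) \<Rightarrow> real \<Rightarrow> real \<Rightarrow> real set \<Rightarrow> (real \<Rightarrow> plane) \<Rightarrow> bool" where
  "constant_speed_ramp m F v \<mu> D \<alpha> \<longleftrightarrow>
     arclength_curve D \<alpha> \<and> sign_condition F D \<alpha> \<and> curvature_equation m F v \<mu> D \<alpha>"

text \<open>The curvature equation is invariant under reversal of orientation (both sides change
  sign), the sign condition is not. A curve is said to define a ramp if it is one for a
  suitable choice of its orientation; the reversed curve is \<open>s \<mapsto> \<alpha> (- s)\<close>
  on \<open>- D\<close>.\<close>

definition defines_ramp ::
  "real \<Rightarrow> (real \<Rightarrow> real) \<Rightarrow> real \<Rightarrow> real \<Rightarrow> real set \<Rightarrow> (real \<Rightarrow> plane) \<Rightarrow> bool" where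
  "defines_ramp m F v \<mu> D \<alpha> \<longleftrightarrow>
     constant_speed_ramp m F v \<mu> D \<alpha> \<or>
     constant_speed_ramp m F v \<mu> (uminus ` D) (\<lambda>s. \<alpha> (- s))"

definition inverse_central_oscillator :: "real \<Rightarrow> real \<Rightarrow> real" where
  "inverse_central_oscillator m r = - m / r"

definition treadmill_sled :: "(real \<Rightarrow> plane) \<Rightarrow> real \<Rightarrow> plane" where
  "treadmill_sled \<alpha> s = - (\<alpha> s \<bullet> tangent \<alpha> s, \<alpha> s \<bullet> normal \<alpha> s)"

text \<open>The whole spiral \<open>r = a e\<^sup>b\<^sup>\<theta>\<close>, \<open>\<theta> \<in> \<real>\<close>, in either orientation. Circles
  (\<open>b = 0\<close>) are excluded. A rotation about the origin only changes \<open>a\<close>, so no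
  phase parameter is needed.\<close>

definition logarithmic_spiral :: "real set \<Rightarrow> (real \<Rightarrow> plane) \<Rightarrow> bool" where
  "logarithmic_spiral D \<alpha> \<longleftrightarrow>
     (\<exists>a b \<theta>. a > 0 \<and> b \<noteq> 0 \<and> continuous_on D \<theta> \<and> bij_betw \<theta> D UNIV \<and>
        (\<forall>s\<in>D. \<alpha> s = (a * exp (b * \<theta> s) * cos (\<theta> s), a * exp (b * \<theta> s) * sin (\<theta> s))))"

definition half_line :: "plane \<Rightarrow> plane set" where
  "half_line u = {t *\<^sub>R u |t. t \<ge> 0}"

text \<open>Equality of arc-length curves up to a rotation about the origin and an
  orientation-preserving change of arc-length parameter, i.e. a translation.\<close>

definition same_up_to_rotation ::
  "real set \<Rightarrow> (real \<Rightarrow> plane) \<Rightarrow> real set \<Rightarrow> (real \<Rightarrow> plane) \<Rightarrow> bool" where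
  "same_up_to_rotation D \<alpha> E \<beta> \<longleftrightarrow>
     (\<exists>\<phi> c. D = (\<lambda>s. s + c) ` E \<and> (\<forall>s\<in>E. \<alpha> (s + c) = rot \<phi> (\<beta> s)))"

text \<open>The origin is removed from the half-line because \<open>\<alpha>\<close>, hence its
  TreadmillSled (which has the same distance to the origin), avoids it.\<close>

definition has_half_line_sled :: "real set \<Rightarrow> (real \<Rightarrow> plane) \<Rightarrow> bool" where
  "has_half_line_sled D \<alpha> \<longleftrightarrow>
     (\<exists>u. u \<noteq> 0 \<and> treadmill_sled \<alpha> ` D = half_line u - {0})"

end

theory Submission
  imports Defs
begin

text \<open>Along a unit-speed logarithmic spiral \<open>r = a e\<^sup>b\<^sup>\<theta>\<close> the radius is an affine
  function of the arc length, and the tangent and normal components of the position are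
  proportional to the radius, which makes the TreadmillSled a half-line. The curvature equation
  then reduces to \<open>b = \<mu> (1 - v\<^sup>2)\<close>, so the shape of the spiral is determined up to
  rotation (a homothety of a spiral is a rotation), and the two ramps are its two orientations.\<close>

section \<open>Polar coordinates and the rotating orthonormal frame\<close>

definition polar :: "real \<Rightarrow> real \<Rightarrow> plane" where
  "polar r \<theta> = (r * cos \<theta>, r * sin \<theta>)"

lemma norm_polar [simp]: "norm (polar r \<theta>) = \<bar>r\<bar>"
proof -
  have "(r * cos \<theta>)\<^sup>2 + (r * sin \<theta>)\<^sup>2 = r\<^sup>2 * ((cos \<theta>)\<^sup>2 + (sin \<theta>)\<^sup>2)"
    by (simp only: power_mult_distrib distrib_left)
  then show ?thesis
    by (simp add: polar_def norm_Pair)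
qed

lemma rot_polar: "rot \<phi> (polar r \<theta>) = polar r (\<theta> + \<phi>)"
  by (simp add: rot_def polar_def cos_add sin_add algebra_simps)

lemma J_simps [simp]:
  "J p \<bullet> J q = p \<bullet> q" "p \<bullet> J p = 0" "J p \<bullet> p = 0" "J (J p) = - p" "norm (J p) = norm p"
  "J (- p) = - J p" "J (p + q) = J p + J q" "J (t *\<^sub>R p) = t *\<^sub>R J p"
  by (simp_all add: J_def inner_prod_def prod_eq_iff norm_prod_def algebra_simps)

lemma polar_scale: "polar r \<theta> = r *\<^sub>R polar 1 \<theta>"
  by (simp add: polar_def)

lemma polar_inner_self [simp]: "polar 1 \<theta> \<bullet> polar 1 \<theta> = 1"
  by (simp add: dot_square_norm)

text \<open>Product and chain rule in each coordinate, regrouped into the radial and angular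
  components of the velocity in the frame \<open>polar 1 \<theta>\<close>,
  \<open>J (polar 1 \<theta>)\<close>.\<close>

lemma polar_has_vector_derivative:
  assumes "(r has_real_derivative r') (at s)" "(\<theta> has_real_derivative \<theta>') (at s)"
  shows "((\<lambda>s. polar (r s) (\<theta> s)) has_vector_derivative
           r' *\<^sub>R polar 1 (\<theta> s) + (r s * \<theta>') *\<^sub>R J (polar 1 (\<theta> s))) (at s)"
proof -
  have "((\<lambda>s. r s * cos (\<theta> s)) has_vector_derivative
           r' * cos (\<theta> s) - r s * \<theta>' * sin (\<theta> s)) (at s)"
    unfolding has_real_derivative_iff_has_vector_derivative [symmetric]
    by (rule derivative_eq_intros assms refl | simp)+
  moreover have "((\<lambda>s. r s * sin (\<theta> s)) has_vector_derivative
           r' * sin (\<theta> s) + r s * \<theta>' * cos (\<theta> s)) (at s)"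
    unfolding has_real_derivative_iff_has_vector_derivative [symmetric]
    by (rule derivative_eq_intros assms refl | simp)+
  ultimately show ?thesis
    using has_vector_derivative_Pair unfolding polar_def J_def by fastforce
qed

text \<open>Pythagoras: the frame is orthonormal, so the mixed terms vanish.\<close>

lemma norm_frame: "(norm (x *\<^sub>R polar 1 \<theta> + y *\<^sub>R J (polar 1 \<theta>)))\<^sup>2 = x\<^sup>2 + y\<^sup>2"
  unfolding dot_square_norm [symmetric]
  by (simp add: inner_add_left inner_add_right power2_eq_square)

section \<open>Spirals with affine radius: domain, reversal and rotation\<close>

text \<open>For \<open>k \<noteq> 0\<close> an open ray ending at \<open>c\<close>, the parameter at
  which the radius \<open>k * (s - c)\<close> would vanish.\<close>

definition spiral_dom :: "real \<Rightarrow> real \<Rightarrow> real set" where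
  "spiral_dom k c = {s. k * (s - c) > 0}"

text \<open>Solves r = a e^(b \<theta>) for the angle at radius \<open>k * (s - c)\<close>, with
  phase \<open>\<phi>\<close> = - ln a / b.\<close>

definition spiral_angle :: "real \<Rightarrow> real \<Rightarrow> real \<Rightarrow> real \<Rightarrow> real \<Rightarrow> real" where
  "spiral_angle b k c \<phi> s = ln (k * (s - c)) / b + \<phi>"

text \<open>Along an arc-length parametrized spiral the radius is an affine function of the
  arc length; \<open>k\<close> is its slope, and the sign of \<open>k\<close> is the orientation.\<close>

definition spiral :: "real \<Rightarrow> real \<Rightarrow> real \<Rightarrow> real \<Rightarrow> real \<Rightarrow> plane" where
  "spiral b k c \<phi> s = polar (k * (s - c)) (spiral_angle b k c \<phi> s)"

lemma spiral_dom_iff: "s \<in> spiral_dom k c \<longleftrightarrow> k * (s - c) > 0"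
  by (simp add: spiral_dom_def)

lemma open_spiral_dom: "open (spiral_dom k c)"
  unfolding spiral_dom_def by (intro open_Collect_less continuous_intros)

lemma is_interval_spiral_dom: "is_interval (spiral_dom k c)"
proof -
  have "spiral_dom k c = (if k > 0 then {c<..} else if k < 0 then {..<c} else {})"
    by (auto simp: spiral_dom_iff zero_less_mult_iff)
  then show ?thesis by simp
qed

lemma spiral_dom_radius:
  assumes "k \<noteq> 0"
  shows "(\<lambda>s. k * (s - c)) ` spiral_dom k c = {0<..}"
proof -
  have "r \<in> (\<lambda>s. k * (s - c)) ` spiral_dom k c" if "r > 0" for r
    by (rule image_eqI [of _ _ "c + r / k"]) (use that assms in \<open>auto simp: spiral_dom_iff\<close>)
  then show ?thesis by (auto simp: spiral_dom_iff)
qed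

lemma spiral_dom_nonempty:
  assumes "k \<noteq> 0"
  obtains s where "s \<in> spiral_dom k c"
  by (rule that [of "c + k"]) (use assms in \<open>auto simp: spiral_dom_iff zero_less_mult_iff\<close>)

lemma spiral_dom_translate: "spiral_dom k c = (\<lambda>s. s + c) ` spiral_dom k 0"
proof (intro set_eqI iffI)
  show "s \<in> (\<lambda>s. s + c) ` spiral_dom k 0" if "s \<in> spiral_dom k c" for s
    by (rule image_eqI [of _ _ "s - c"]) (use that in \<open>simp_all add: spiral_dom_iff\<close>)
qed (auto simp: spiral_dom_iff)

lemma spiral_dom_reverse: "uminus ` spiral_dom k c = spiral_dom (- k) (- c)"
proof (intro set_eqI iffI)
  show "s \<in> uminus ` spiral_dom k c" if "s \<in> spiral_dom (- k) (- c)" for s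
    by (rule image_eqI [of _ _ "- s"]) (use that in \<open>simp_all add: spiral_dom_iff algebra_simps\<close>)
qed (auto simp: spiral_dom_iff algebra_simps)

text \<open>The curve depends on \<open>s\<close> only through the radius
  \<open>k * (s - c)\<close>, which is unchanged when \<open>s\<close>, \<open>k\<close> and
  \<open>c\<close> all change sign. Reversal therefore flips the slope \<open>k\<close> and keeps
  the shape \<open>b\<close>.\<close>

lemma spiral_reverse: "spiral b k c \<phi> (- s) = spiral b (- k) (- c) \<phi> s"
proof -
  have "k * (- s - c) = - k * (s - - c)" by (simp add: algebra_simps)
  then show ?thesis unfolding spiral_def spiral_angle_def by presburger
qed

lemma spiral_rot: "spiral b k c \<phi> (s + c) = rot \<phi> (spiral b k 0 0 s)"
  by (simp add: spiral_def spiral_angle_def rot_polar)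

text \<open>The rotation absorbs the phase \<open>\<phi>\<close> and the translation absorbs the
  endpoint \<open>c\<close>, so that only \<open>b\<close> and \<open>k\<close> distinguish
  spirals.\<close>

lemma same_up_to_rotation_spiral:
  assumes "\<And>s. s \<in> spiral_dom k c \<Longrightarrow> \<alpha> s = spiral b k c \<phi> s"
  shows "same_up_to_rotation (spiral_dom k c) \<alpha> (spiral_dom k 0) (spiral b k 0 0)"
  unfolding same_up_to_rotation_def
proof (intro exI conjI ballI)
  show "spiral_dom k c = (\<lambda>s. s + c) ` spiral_dom k 0" by (rule spiral_dom_translate)
  show "\<alpha> (s + c) = rot \<phi> (spiral b k 0 0 s)" if "s \<in> spiral_dom k 0" for s
    using that assms [of "s + c"] by (simp add: spiral_dom_iff spiral_rot)
qed

text \<open>The two rays point in opposite directions wherever they end. This tells the two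
  orientations apart.\<close>

lemma spiral_dom_opposite:
  assumes "k \<noteq> 0"
  shows "spiral_dom k c \<noteq> spiral_dom (- k) d"
proof
  assume eq: "spiral_dom k c = spiral_dom (- k) d"
  \<comment> \<open>A point beyond both endpoints lies in exactly the ray that extends to the
    right.\<close>
  define x where "x = max (c + 1) (d + 1)"
  have "x \<in> spiral_dom k c \<longleftrightarrow> x \<notin> spiral_dom (- k) d"
    using assms unfolding spiral_dom_iff x_def zero_less_mult_iff by auto
  with eq show False by simp
qed

text \<open>In the locale, the condition on \<open>k\<close> is unit speed.\<close>

locale spiral_curve =
  fixes b k c \<phi> :: real and \<alpha> :: "real \<Rightarrow> plane"
  assumes b: "b \<noteq> 0" and speed: "k\<^sup>2 * (1 + b\<^sup>2) = b\<^sup>2"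
    and eq: "\<And>s. s \<in> spiral_dom k c \<Longrightarrow> \<alpha> s = spiral b k c \<phi> s"
begin

abbreviation "D \<equiv> spiral_dom k c"
abbreviation "e s \<equiv> polar 1 (spiral_angle b k c \<phi> s)"

section \<open>Tangent, curvature and TreadmillSled components of a unit-speed spiral\<close>

lemma k: "k \<noteq> 0"
  using b speed by auto

lemma speed': "k * k + k / b * (k / b) = 1"
  using b speed by (simp add: field_simps power2_eq_square)

lemma angle_derivative:
  assumes "s \<in> D"
  shows "(spiral_angle b k c \<phi> has_real_derivative 1 / (b * (s - c))) (at s)"
proof -
  have "(spiral_angle b k c \<phi> has_real_derivative k / (k * (s - c)) / b) (at s)"
    unfolding spiral_angle_def
    using assms b by (auto intro!: derivative_eq_intros simp: spiral_dom_iff)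
  moreover have "k / (k * (s - c)) / b = 1 / (b * (s - c))"
    using k by (simp add: mult.commute)
  ultimately show ?thesis by simp
qed

text \<open>Curves are prescribed on \<open>D\<close> alone; as \<open>D\<close> is open, agreement
  on it is enough to transfer a derivative at any of its points.\<close>

lemma has_vector_derivative_eq:
  assumes "s \<in> D" "(f has_vector_derivative f') (at s)" "\<And>t. t \<in> D \<Longrightarrow> g t = f t"
  shows "(g has_vector_derivative f') (at s)"
  by (rule has_vector_derivative_transform_within_open [OF assms(2) open_spiral_dom assms(1)])
    (simp add: assms(3))

lemma position: "s \<in> D \<Longrightarrow> \<alpha> s = (k * (s - c)) *\<^sub>R e s"
  using eq unfolding spiral_def by (metis polar_scale)

text \<open>The radius has slope \<open>k\<close>, and radius times angular velocity is
  \<open>k / b\<close>. Both frame components are constant: the spiral is equiangular.\<close>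

lemma has_tangent:
  assumes "s \<in> D"
  shows "(\<alpha> has_vector_derivative k *\<^sub>R e s + (k / b) *\<^sub>R J (e s)) (at s)"
proof (rule has_vector_derivative_eq [OF assms _ eq])
  have "((\<lambda>s. k * (s - c)) has_real_derivative k) (at s)"
    by (auto intro!: derivative_eq_intros)
  note polar_has_vector_derivative [OF this angle_derivative [OF assms]]
  moreover have "k * (s - c) * (1 / (b * (s - c))) = k / b"
    using assms by (auto simp: spiral_dom_iff)
  ultimately show "(spiral b k c \<phi> has_vector_derivative k *\<^sub>R e s + (k / b) *\<^sub>R J (e s)) (at s)"
    unfolding spiral_def by simp
qed

lemma tangent: "s \<in> D \<Longrightarrow> tangent \<alpha> s = k *\<^sub>R e s + (k / b) *\<^sub>R J (e s)"
  unfolding tangent_def using has_tangent by (rule vector_derivative_at)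

lemma normal: "s \<in> D \<Longrightarrow> normal \<alpha> s = k *\<^sub>R J (e s) - (k / b) *\<^sub>R e s"
  by (simp add: normal_def tangent)

text \<open>With constant components only the frame turns: if \<omega> is the angular velocity, then
  e' = \<omega> J e and (J e)' = - \<omega> e, so the tangent turns at the rate \<omega> as well,
  and the curvature is \<omega>.\<close>

lemma has_acceleration:
  assumes "s \<in> D"
  shows "(tangent \<alpha> has_vector_derivative (1 / (b * (s - c))) *\<^sub>R normal \<alpha> s) (at s)"
proof (rule has_vector_derivative_eq [OF assms _ tangent])
  have 1: "(e has_vector_derivative (1 / (b * (s - c))) *\<^sub>R J (e s)) (at s)"
    using polar_has_vector_derivative [OF DERIV_const angle_derivative [OF assms], of 1] by simp
  have "bounded_linear J"
    by (rule bounded_linear_intro [of _ 1]) simp_all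
  from bounded_linear.has_vector_derivative [OF this 1]
  have 2: "((\<lambda>s. J (e s)) has_vector_derivative (1 / (b * (s - c))) *\<^sub>R - e s) (at s)"
    by simp
  show "((\<lambda>s. k *\<^sub>R e s + (k / b) *\<^sub>R J (e s)) has_vector_derivative
      (1 / (b * (s - c))) *\<^sub>R normal \<alpha> s) (at s)"
    by (rule derivative_eq_intros 1 2 refl)+ (simp add: normal [OF assms] algebra_simps)
qed

lemma acceleration: "s \<in> D \<Longrightarrow> acceleration \<alpha> s = (1 / (b * (s - c))) *\<^sub>R normal \<alpha> s"
  unfolding acceleration_def using has_acceleration by (rule vector_derivative_at)

lemma norm_tangent: "s \<in> D \<Longrightarrow> norm (tangent \<alpha> s) = 1"
  using norm_frame [of k "spiral_angle b k c \<phi> s" "k / b"] speed'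
  by (simp add: tangent power2_eq_square abs_square_eq_1 flip: power2_eq_square)

lemma norm_normal: "s \<in> D \<Longrightarrow> norm (normal \<alpha> s) = 1"
  by (simp add: normal_def norm_tangent)

lemma norm_position: "s \<in> D \<Longrightarrow> norm (\<alpha> s) = k * (s - c)"
  by (simp add: eq spiral_def spiral_dom_iff)

lemma curvature: "s \<in> D \<Longrightarrow> curvature \<alpha> s = 1 / (b * (s - c))"
  by (simp add: curvature_def acceleration dot_square_norm norm_normal)

lemma position_tangent: "s \<in> D \<Longrightarrow> \<alpha> s \<bullet> tangent \<alpha> s = k * (s - c) * k"
  by (simp add: position tangent inner_add_right)

lemma position_normal: "s \<in> D \<Longrightarrow> \<alpha> s \<bullet> normal \<alpha> s = - (k * (s - c) * (k / b))"
  by (simp add: position normal inner_diff_right)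

section \<open>Arc-length regularity, spiral form and half-line TreadmillSled\<close>

lemma arclength: "arclength_curve D \<alpha>"
  unfolding arclength_curve_def
proof (intro conjI ballI open_spiral_dom is_interval_spiral_dom)
  show "D \<noteq> {}" using spiral_dom_nonempty [OF k] by blast
  \<comment> \<open>This is the formula for the acceleration; its factor is singular only at
    \<open>c\<close>, which lies outside \<open>D\<close>.\<close>
  have "continuous_on D (\<lambda>s. (1 / (b * (s - c))) *\<^sub>R normal \<alpha> s)"
  proof (intro continuous_intros)
    have "continuous_on D (tangent \<alpha>)"
      using has_acceleration has_vector_derivative_continuous
      by (meson continuous_at_imp_continuous_on)
    then show "continuous_on D (normal \<alpha>)"
      unfolding normal_def J_def by (intro continuous_intros)
  qed (auto simp: b spiral_dom_iff)
  then show "continuous_on D (acceleration \<alpha>)"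
    using acceleration by (simp cong: continuous_on_cong)
next
  fix s assume s: "s \<in> D"
  show "\<alpha> differentiable at s"
    using has_tangent [OF s] by (rule differentiableI_vector)
  show "Defs.tangent \<alpha> differentiable at s"
    using has_acceleration [OF s] by (rule differentiableI_vector)
  show "norm (Defs.tangent \<alpha> s) = 1" using s by (rule norm_tangent)
  show "\<alpha> s \<noteq> 0" using norm_position [OF s] s by (auto simp: spiral_dom_iff)
qed

lemma log_spiral: "logarithmic_spiral D \<alpha>"
  unfolding logarithmic_spiral_def
proof (intro exI conjI ballI)
  \<comment> \<open>The scale a is recovered from the phase through \<open>\<phi>\<close> = - ln a /
    b.\<close>
  show "exp (- b * \<phi>) > 0" "b \<noteq> 0" using b by auto
  show "continuous_on D (spiral_angle b k c \<phi>)"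
    using angle_derivative DERIV_isCont continuous_at_imp_continuous_on by blast
  show "bij_betw (spiral_angle b k c \<phi>) D UNIV"
  proof (rule bij_betwI')
    show "spiral_angle b k c \<phi> x = spiral_angle b k c \<phi> y \<longleftrightarrow> x = y"
      if "x \<in> D" "y \<in> D" for x y
      using that b k by (auto simp: spiral_angle_def spiral_dom_iff)
    show "\<exists>x\<in>D. t = spiral_angle b k c \<phi> x" for t
      \<comment> \<open>The parameter at which the radius equals
        \<open>exp (b * (t - \<phi>))\<close>.\<close>
      by (rule bexI [of _ "c + exp (b * (t - \<phi>)) / k"])
        (use b k in \<open>auto simp: spiral_angle_def spiral_dom_iff\<close>)
  qed simp
  fix s assume s: "s \<in> D"
  have "exp (- b * \<phi>) * exp (b * spiral_angle b k c \<phi> s) = k * (s - c)"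
    using s b by (simp add: spiral_angle_def spiral_dom_iff distrib_left flip: exp_add)
  then show "\<alpha> s =
      (exp (- b * \<phi>) * exp (b * spiral_angle b k c \<phi> s) * cos (spiral_angle b k c \<phi> s),
       exp (- b * \<phi>) * exp (b * spiral_angle b k c \<phi> s) * sin (spiral_angle b k c \<phi> s))"
    by (simp add: eq [OF s] spiral_def polar_def)
qed

text \<open>Both sled components are the radius times a constant, and the radius runs through all
  positive reals.\<close>

lemma half_line_sled: "has_half_line_sled D \<alpha>"
  unfolding has_half_line_sled_def
proof (intro exI conjI)
  let ?u = "(- k, k / b)"
  show u: "?u \<noteq> 0" using k by (simp add: zero_prod_def)
  have "treadmill_sled \<alpha> ` D = (\<lambda>s. (k * (s - c)) *\<^sub>R ?u) ` D"
    by (rule image_cong) (auto simp: treadmill_sled_def position_tangent position_normal)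
  also have "\<dots> = (\<lambda>r. r *\<^sub>R ?u) ` {0<..}"
    unfolding spiral_dom_radius [OF k, of c, symmetric] image_image ..
  also have "\<dots> = half_line ?u - {0}"
  proof (intro set_eqI iffI)
    fix p assume "p \<in> half_line ?u - {0}"
    then obtain t where t: "t \<ge> 0" "p = t *\<^sub>R ?u" "p \<noteq> 0" unfolding half_line_def by blast
    then have "t \<noteq> 0" using scaleR_zero_left by metis
    with t show "p \<in> (\<lambda>r. r *\<^sub>R ?u) ` {0<..}"
      by (intro image_eqI [of _ _ t]) auto
  next
    fix p assume "p \<in> (\<lambda>r. r *\<^sub>R ?u) ` {0<..}"
    then obtain t where t: "t > 0" "p = t *\<^sub>R ?u" by (auto simp del: scaleR_Pair)
    then have "p \<noteq> 0" using u by (metis less_irrefl scaleR_eq_0_iff)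
    moreover have "p \<in> half_line ?u"
      unfolding half_line_def using t less_imp_le by blast
    ultimately show "p \<in> half_line ?u - {0}" by simp
  qed
  finally show "treadmill_sled \<alpha> ` D = half_line ?u - {0}" .
qed

section \<open>The ramp conditions in terms of \<open>b\<close> and \<open>k\<close>\<close>

text \<open>Both sides of the equation are \<open>k / r\<close> times a constant, where
  \<open>r\<close> is the radius. Cancelling this nonzero factor leaves 1/b = (1/b - 1/\<mu>)/v^2,
  in which \<open>s\<close> no longer occurs.\<close>

lemma curvature_equation_iff:
  assumes "m > 0" "v > 0" "\<mu> > 0"
  shows "curvature_equation m (inverse_central_oscillator m) v \<mu> D \<alpha> \<longleftrightarrow> b = \<mu> * (1 - v\<^sup>2)"
proof -
  have "(curvature \<alpha> s =
        inverse_central_oscillator m (norm (\<alpha> s)) / (m * v\<^sup>2 * norm (\<alpha> s)) *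
        ((\<alpha> s \<bullet> Defs.tangent \<alpha> s) / \<mu> + \<alpha> s \<bullet> Defs.normal \<alpha> s)) \<longleftrightarrow> b = \<mu> * (1 - v\<^sup>2)"
    if s: "s \<in> D" for s
  proof -
    define r where "r = k * (s - c)"
    have r: "r > 0" using s by (simp add: r_def spiral_dom_iff)
    have "1 / (b * (s - c)) = k / (b * r)" using k by (simp add: r_def)
    moreover have "k / (b * r) = - m / r / (m * v\<^sup>2 * r) * (r * k / \<mu> + - (r * (k / b)))
        \<longleftrightarrow> b = \<mu> * (1 - v\<^sup>2)"
    proof -
      have "- m / r / (m * v\<^sup>2 * r) * (r * k / \<mu> + - (r * (k / b)))
          = k / r * ((1 / b - 1 / \<mu>) / v\<^sup>2)"
        using r b assms by (simp add: field_simps power2_eq_square)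
      moreover have "k / (b * r) = k / r * (1 / b)" by simp
      moreover have "1 / b = (1 / b - 1 / \<mu>) / v\<^sup>2 \<longleftrightarrow> b = \<mu> * (1 - v\<^sup>2)"
        using b assms by (auto simp: field_simps)
      ultimately show ?thesis
        using k r by (metis divide_eq_0_iff less_irrefl mult_left_cancel)
    qed
    ultimately show ?thesis
      using s by (simp add: curvature norm_position position_tangent position_normal
          inverse_central_oscillator_def r_def)
  qed
  then show ?thesis
    unfolding curvature_equation_def by (metis spiral_dom_nonempty [OF k])
qed

text \<open>The left side of the condition is - (m / r) k with \<open>k\<close> nonzero. As the
  force is attractive, the ramp must run towards the origin.\<close>

lemma sign_condition_iff:
  assumes "m > 0"
  shows "sign_condition (inverse_central_oscillator m) D \<alpha> \<longleftrightarrow> k < 0"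
proof -
  have "inverse_central_oscillator m (norm (\<alpha> s)) / norm (\<alpha> s) *
      (\<alpha> s \<bullet> Defs.tangent \<alpha> s) \<ge> 0 \<longleftrightarrow> k < 0" if s: "s \<in> D" for s
  proof -
    define r where "r = k * (s - c)"
    have r: "r > 0" using s by (simp add: r_def spiral_dom_iff)
    have "- m / r / r * (r * k) = (m / r) * (- k)" using r by simp
    moreover have "(m / r) * (- k) \<ge> 0 \<longleftrightarrow> k < 0"
      using divide_pos_pos [OF assms r] k by (simp only: zero_le_mult_iff) linarith
    ultimately show ?thesis
      unfolding norm_position [OF s] position_tangent [OF s] inverse_central_oscillator_def
        r_def [symmetric] by simp
  qed
  then show ?thesis
    unfolding sign_condition_def by (metis spiral_dom_nonempty [OF k])
qed

lemma constant_speed_ramp_iff: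
  assumes "m > 0" "v > 0" "\<mu> > 0"
  shows "constant_speed_ramp m (inverse_central_oscillator m) v \<mu> D \<alpha> \<longleftrightarrow>
    k < 0 \<and> b = \<mu> * (1 - v\<^sup>2)"
  using assms arclength by (simp add: constant_speed_ramp_def curvature_equation_iff sign_condition_iff)

end

text \<open>The reversed curve is again such a spiral, with the same \<open>b\<close> and with
  \<open>- k\<close> in place of \<open>k\<close>, so exactly one of the two orientations meets the
  sign condition.\<close>

lemma (in spiral_curve) defines_ramp_iff:
  assumes "m > 0" "v > 0" "\<mu> > 0"
  shows "defines_ramp m (inverse_central_oscillator m) v \<mu> D \<alpha> \<longleftrightarrow> b = \<mu> * (1 - v\<^sup>2)"
proof -
  interpret rev: spiral_curve b "- k" "- c" \<phi> "\<lambda>s. \<alpha> (- s)"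
  proof
    show "\<alpha> (- s) = spiral b (- k) (- c) \<phi> s" if "s \<in> spiral_dom (- k) (- c)" for s
      using that eq [of "- s"] unfolding spiral_reverse [symmetric]
      by (simp add: spiral_dom_iff algebra_simps)
  qed (use b speed in auto)
  show ?thesis
    using constant_speed_ramp_iff [OF assms] rev.constant_speed_ramp_iff [OF assms] k
    unfolding defines_ramp_def spiral_dom_reverse by auto
qed

section \<open>Every arc-length logarithmic spiral has affine radius\<close>

text \<open>Unit speed fixes the square of the derivative of the radius. That derivative is
  continuous on an interval, hence constant, and the radius is affine.\<close>

lemma logarithmic_spiral_is_spiral_curve:
  assumes "arclength_curve D \<alpha>" "logarithmic_spiral D \<alpha>"
  obtains b k c \<phi> where "spiral_curve b k c \<phi> \<alpha>" "D = spiral_dom k c"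
proof -
  from assms(2) obtain a b \<theta> where a: "a > 0" and b: "b \<noteq> 0" and bij: "bij_betw \<theta> D UNIV"
    and \<alpha>: "\<And>s. s \<in> D \<Longrightarrow> \<alpha> s = polar (a * exp (b * \<theta> s)) (\<theta> s)"
    unfolding logarithmic_spiral_def polar_def by blast
  from assms(1) have D: "open D" "is_interval D" "D \<noteq> {}"
    and diff: "\<And>s. s \<in> D \<Longrightarrow> \<alpha> differentiable (at s)" "\<And>s. s \<in> D \<Longrightarrow> tangent \<alpha> differentiable (at s)"
    and unit: "\<And>s. s \<in> D \<Longrightarrow> norm (tangent \<alpha> s) = 1"
    and nz: "\<And>s. s \<in> D \<Longrightarrow> \<alpha> s \<noteq> 0"
    unfolding arclength_curve_def by auto
  define r where "r = (\<lambda>s. norm (\<alpha> s))"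
  \<comment> \<open>The candidate for the derivative of \<open>r\<close>: the tangent's component
    along the unit radial vector.\<close>
  define g where "g = (\<lambda>s. (\<alpha> s \<bullet> tangent \<alpha> s) / r s)"
  have r_eq: "r s = a * exp (b * \<theta> s)" if "s \<in> D" for s
    using that a by (simp add: r_def \<alpha>)
  have r_pos: "r s > 0" if "s \<in> D" for s
    using nz [OF that] by (simp add: r_def)
  \<comment> \<open>Differentiability of \<open>\<theta>\<close> is not part of the definition of a
    spiral; it is inherited from \<open>r\<close> through this formula.\<close>
  have \<theta>_eq: "\<theta> s = ln (r s / a) / b" if "s \<in> D" for s
    using that a b by (simp add: r_eq)
  have der: "(\<alpha> has_vector_derivative tangent \<alpha> s) (at s)" if "s \<in> D" for s
    using diff(1) [OF that] by (simp add: tangent_def vector_derivative_works)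
  have r_der: "(r has_real_derivative g s) (at s)" if s: "s \<in> D" for s
  proof -
    have "((\<lambda>s. sqrt (\<alpha> s \<bullet> \<alpha> s)) has_real_derivative g s) (at s)"
    proof -
      have pos: "\<alpha> s \<bullet> \<alpha> s > 0" using nz [OF s] by simp
      have "((\<lambda>s. \<alpha> s \<bullet> \<alpha> s) has_real_derivative 2 * (\<alpha> s \<bullet> tangent \<alpha> s)) (at s)"
        using der [OF s] unfolding has_real_derivative_iff_has_vector_derivative has_vector_derivative_def
        by (auto intro!: derivative_eq_intros simp: inner_commute)
      from DERIV_chain2 [OF DERIV_real_sqrt [OF pos] this]
      show ?thesis
        by (simp add: g_def r_def norm_eq_sqrt_inner field_simps)
    qed
    then show ?thesis by (simp add: r_def norm_eq_sqrt_inner)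
  qed
  have g_sq: "(g s)\<^sup>2 * (1 + b\<^sup>2) = b\<^sup>2" if s: "s \<in> D" for s
  proof -
    have "((\<lambda>s. ln (r s / a) / b) has_real_derivative g s / (b * r s)) (at s)"
      using r_der [OF s] r_pos [OF s] a b by (auto intro!: derivative_eq_intros)
    then have "(\<theta> has_real_derivative g s / (b * r s)) (at s)"
      by (rule has_field_derivative_transform_within_open [OF _ D(1) s]) (simp add: \<theta>_eq)
    from polar_has_vector_derivative [OF r_der [OF s] this]
    have "((\<lambda>s. polar (r s) (\<theta> s)) has_vector_derivative
        g s *\<^sub>R polar 1 (\<theta> s) + (g s / b) *\<^sub>R J (polar 1 (\<theta> s))) (at s)"
      using r_pos [OF s] by simp
    then have "(\<alpha> has_vector_derivative
        g s *\<^sub>R polar 1 (\<theta> s) + (g s / b) *\<^sub>R J (polar 1 (\<theta> s))) (at s)"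
      by (rule has_vector_derivative_transform_within_open [OF _ D(1) s]) (simp add: \<alpha> r_eq)
    then have "tangent \<alpha> s = g s *\<^sub>R polar 1 (\<theta> s) + (g s / b) *\<^sub>R J (polar 1 (\<theta> s))"
      unfolding tangent_def by (rule vector_derivative_at)
    \<comment> \<open>Unit speed, with radial component r' and angular component r \<theta>' = r' /
      b.\<close>
    then have "(g s)\<^sup>2 + (g s / b)\<^sup>2 = 1"
      using norm_frame [of "g s" "\<theta> s" "g s / b"] unit [OF s] by simp
    then show ?thesis using b by (simp add: field_simps)
  qed
  obtain k where k: "\<And>s. s \<in> D \<Longrightarrow> g s = k"
  proof -
    have "continuous_on D \<alpha>" "continuous_on D (tangent \<alpha>)"
      using diff by (simp_all add: continuous_at_imp_continuous_on differentiable_imp_continuous_within)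
    then have "continuous_on D g"
      using nz unfolding g_def r_def by (intro continuous_intros) auto
    \<comment> \<open>Only two values are possible, so by connectedness \<open>g\<close> cannot jump
      from one to the other.\<close>
    moreover have "finite (g ` D)"
    proof (rule finite_subset)
      let ?h = "sqrt (b\<^sup>2 / (1 + b\<^sup>2))"
      have "1 + b\<^sup>2 > 0" by (simp add: add_pos_nonneg)
      then have "(g s)\<^sup>2 = ?h\<^sup>2" if "s \<in> D" for s
        using g_sq [OF that] by (simp add: field_simps)
      then show "g ` D \<subseteq> {?h, - ?h}" unfolding power2_eq_iff by blast
    qed simp
    ultimately have "g constant_on D"
      using continuous_finite_range_constant D(2) is_interval_connected by blast
    then show thesis using that unfolding constant_on_def by blast
  qed
  have k_sq: "k\<^sup>2 * (1 + b\<^sup>2) = b\<^sup>2" using g_sq k D(3) by fastforce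
  then have k0: "k \<noteq> 0" using b by auto
  obtain d where d: "\<And>s. s \<in> D \<Longrightarrow> r s - k * s = d"
  proof -
    have "((\<lambda>s. r s - k * s) has_real_derivative 0) (at s within D)" if "s \<in> D" for s
      using DERIV_diff [OF r_der [OF that] DERIV_cmult [OF DERIV_ident, of k]]
      by (simp add: k [OF that] has_field_derivative_at_within)
    then show thesis
      using that has_field_derivative_zero_constant [of D] D(2) is_interval_convex by metis
  qed
  \<comment> \<open>The zero of the affine radius \<open>k * s + d\<close>.\<close>
  define c where "c = - d / k"
  have r: "r s = k * (s - c)" if "s \<in> D" for s
    using d [OF that] k0 by (simp add: c_def field_simps)
  have D_eq: "D = spiral_dom k c"
  proof (intro set_eqI iffI)
    fix s assume "s \<in> D"
    then show "s \<in> spiral_dom k c" using r_pos r by (simp add: spiral_dom_iff)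
  next
    fix s assume s: "s \<in> spiral_dom k c"
    \<comment> \<open>The angle takes every real value, so every positive radius is attained on
      \<open>D\<close>; an affine radius with \<open>k \<noteq> 0\<close> determines the parameter,
      which gives \<open>t = s\<close>.\<close>
    obtain t where t: "t \<in> D" "\<theta> t = ln (k * (s - c) / a) / b"
      using bij by (metis UNIV_I bij_betw_iff_bijections)
    then have "r t = k * (s - c)" using a b s by (simp add: r_eq spiral_dom_iff)
    with r [OF t(1)] k0 t(1) show "s \<in> D" by simp
  qed
  have "spiral_curve b k c (- ln a / b) \<alpha>"
  proof
    fix s assume "s \<in> spiral_dom k c"
    then have s: "s \<in> D" by (simp add: D_eq)
    have "ln (r s / a) = ln (r s) - ln a"
      using r_pos [OF s] a by (simp add: ln_div)
    then have "\<theta> s = spiral_angle b k c (- ln a / b) s"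
      using \<theta>_eq [OF s] unfolding r [OF s] spiral_angle_def by (simp add: diff_divide_distrib)
    then show "\<alpha> s = spiral b k c (- ln a / b) s"
      using \<alpha> [OF s] r_eq [OF s] r [OF s] by (simp add: spiral_def)
  qed (use b k_sq in auto)
  with D_eq show thesis using that by blast
qed

section \<open>The two orientations of the spiral with \<open>b = \<mu> * (1 - v\<^sup>2)\<close>:
  existence, distinctness, completeness\<close>

theorem theorem4p1:
  fixes m v \<mu> :: real
  assumes "m > 0" and "v > 0" and "v \<noteq> 1" and "\<mu> > 0"
  defines "F \<equiv> inverse_central_oscillator m"
  shows "\<exists>D\<^sub>1 \<alpha>\<^sub>1 D\<^sub>2 \<alpha>\<^sub>2.
      arclength_curve D\<^sub>1 \<alpha>\<^sub>1 \<and> logarithmic_spiral D\<^sub>1 \<alpha>\<^sub>1 \<and>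
      defines_ramp m F v \<mu> D\<^sub>1 \<alpha>\<^sub>1 \<and> has_half_line_sled D\<^sub>1 \<alpha>\<^sub>1 \<and>
      arclength_curve D\<^sub>2 \<alpha>\<^sub>2 \<and> logarithmic_spiral D\<^sub>2 \<alpha>\<^sub>2 \<and>
      defines_ramp m F v \<mu> D\<^sub>2 \<alpha>\<^sub>2 \<and> has_half_line_sled D\<^sub>2 \<alpha>\<^sub>2 \<and>
      \<not> same_up_to_rotation D\<^sub>1 \<alpha>\<^sub>1 D\<^sub>2 \<alpha>\<^sub>2 \<and>
      (\<forall>D \<alpha>. arclength_curve D \<alpha> \<and> logarithmic_spiral D \<alpha> \<and> defines_ramp m F v \<mu> D \<alpha> \<longrightarrow>
         same_up_to_rotation D \<alpha> D\<^sub>1 \<alpha>\<^sub>1 \<or> same_up_to_rotation D \<alpha> D\<^sub>2 \<alpha>\<^sub>2)"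
proof -
  define b where "b = \<mu> * (1 - v\<^sup>2)"
  \<comment> \<open>A root of the unit-speed equation k^2 (1 + b^2) = b^2; the other root
    \<open>- h\<close> gives the opposite orientation.\<close>
  define h where "h = b / sqrt (1 + b\<^sup>2)"
  \<comment> \<open>The value \<open>b = 0\<close> would force v = 1 or v = -1; it would be a circle
    instead of a spiral.\<close>
  have b: "b \<noteq> 0"
    using assms(2-4) by (auto simp: b_def power2_eq_1_iff)
  have pos: "1 + b\<^sup>2 > 0" by (simp add: add_pos_nonneg)
  then have h_sq: "h\<^sup>2 * (1 + b\<^sup>2) = b\<^sup>2" by (simp add: h_def power_divide)
  have h: "h \<noteq> 0" using h_sq b by auto
  interpret S1: spiral_curve b h 0 0 "spiral b h 0 0"
    by unfold_locales (use b h_sq in auto)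
  interpret S2: spiral_curve b "- h" 0 0 "spiral b (- h) 0 0"
    by unfold_locales (use b h_sq in auto)
  \<comment> \<open>A translation preserves the direction of a ray, and the two domains point in
    opposite directions.\<close>
  have distinct: "\<not> same_up_to_rotation (spiral_dom h 0) (spiral b h 0 0)
      (spiral_dom (- h) 0) (spiral b (- h) 0 0)"
    unfolding same_up_to_rotation_def spiral_dom_translate [symmetric]
    using spiral_dom_opposite [OF h] by blast
  have unique: "same_up_to_rotation D \<alpha> (spiral_dom h 0) (spiral b h 0 0) \<or>
      same_up_to_rotation D \<alpha> (spiral_dom (- h) 0) (spiral b (- h) 0 0)"
    if "arclength_curve D \<alpha>" "logarithmic_spiral D \<alpha>" and ramp: "defines_ramp m F v \<mu> D \<alpha>" for D \<alpha>
  proof -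
    obtain b' k c \<phi> where S: "spiral_curve b' k c \<phi> \<alpha>" and D: "D = spiral_dom k c"
      using logarithmic_spiral_is_spiral_curve \<open>arclength_curve D \<alpha>\<close> \<open>logarithmic_spiral D \<alpha>\<close> .
    interpret spiral_curve b' k c \<phi> \<alpha> by (rule S)
    \<comment> \<open>The curvature equation determines the shape.\<close>
    have b': "b' = b"
      using ramp defines_ramp_iff assms unfolding F_def D b_def by blast
    \<comment> \<open>With equal \<open>b\<close>, both slopes solve the same unit-speed equation,
      so they agree up to sign.\<close>
    have "k\<^sup>2 = h\<^sup>2"
      using speed h_sq pos unfolding b' by (metis less_irrefl mult_right_cancel)
    then have "k = h \<or> k = - h" by (simp add: power2_eq_iff)
    then show ?thesis
      using same_up_to_rotation_spiral [OF eq] unfolding D b' by auto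
  qed
  have "defines_ramp m F v \<mu> (spiral_dom h 0) (spiral b h 0 0)"
    "defines_ramp m F v \<mu> (spiral_dom (- h) 0) (spiral b (- h) 0 0)"
    using S1.defines_ramp_iff S2.defines_ramp_iff assms b_def by simp_all
  then show ?thesis
    using S1.arclength S1.log_spiral S1.half_line_sled
      S2.arclength S2.log_spiral S2.half_line_sled distinct unique
    by (intro exI [of _ "spiral_dom h 0"] exI [of _ "spiral b h 0 0"]
        exI [of _ "spiral_dom (- h) 0"] exI [of _ "spiral b (- h) 0 0"]) simp
qed

end
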